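(* Let $n\ge 1$. For any $f(\xi,z)\in\mathbb{C}[\xi,z]$, one has $f(\xi,z)\in\operatorname{Im}\Theta$ if and only if the holomorphic part of the Laurent polynomial $\mathcal{Z}(f(\xi,z))$ is equal to zero.
   Context: Here $z=(z_1,\dots,z_n)$ and $\xi=(\xi_1,\dots,\xi_n)$ are commuting free variables and $\partial_i:=\partial/\partial z_i$. Put $\Theta_i:=\xi_i-\partial_i$ ($1\le i\le n$), a differential operator of $\mathbb{C}[\xi,z]$, $\Theta:=\{\Theta_1,\dots,\Theta_n\}$, and $\operatorname{Im}\Theta:=\sum_{i=1}^n\Theta_i(\mathbb{C}[\xi,z])$. Let $\mathbb{C}[z^{-1},z]$ be the algebra of Laurent polynomials in $z_1,\dots,z_n$. The $\mathbb{C}$-linear map $\mathcal{Z}:\mathbb{C}[\xi,z]\to\mathbb{C}[z^{-1},z]$ is defined by $\mathcal{Z}(g(\xi)z^\beta):=\beta!\,g(z^{-1})\,z^\beta$ for $g(\xi)\in\mathbb{C}[\xi]$, $\beta\in\mathbb{N}^n$, where $g(z^{-1})$ is obtained by replacing each $\xi_i$ with $z_i^{-1}$, $\beta!:=\beta_1!\cdots\beta_n!$, and $\mathbb{N}$ includes $0$. The holomorphic part of $q(z)\in\mathbb{C}[z^{-1},z]$ is said to be zero if the coefficient of $z^\gamma$ in $q(z)$ is zero for every $\gamma\in\mathbb{N}^n$. *)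

theory Defs
  imports Complex_Main "HOL-Library.Poly_Mapping" "HOL-Library.Product_Plus"
begin

text \<open>
  The index set of the variables is a type \<open>'n\<close> of class \<^class>\<open>finite\<close>, so n is its
  (automatically positive) cardinality. Polynomial and Laurent polynomial rings are monoid
  algebras: \<open>single (\<alpha>, \<beta>) c\<close> is the monomial c \<xi>^\<alpha> z^\<beta> of C[\<xi>,z], and in C[z^{-1},z] the
  exponents are integer-valued. The ring operations are those of \<^type>\<open>poly_mapping\<close>.
\<close>

type_synonym 'n expo = "'n \<Rightarrow>\<^sub>0 nat"
type_synonym 'n xz_poly = "('n expo \<times> 'n expo) \<Rightarrow>\<^sub>0 complex"
type_synonym 'n laurent_poly = "('n \<Rightarrow>\<^sub>0 int) \<Rightarrow>\<^sub>0 complex"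

abbreviation const :: "complex \<Rightarrow> 'a::monoid_add \<Rightarrow>\<^sub>0 complex"
  where "const c \<equiv> Poly_Mapping.single 0 c"

definition xi :: "'n \<Rightarrow> 'n xz_poly"
  where "xi i = Poly_Mapping.single (Poly_Mapping.single i 1, 0) 1"

definition zz :: "'n \<Rightarrow> 'n xz_poly"
  where "zz i = Poly_Mapping.single (0, Poly_Mapping.single i 1) 1"

text \<open>
  The truncated subtraction below is harmless: if \<open>\<beta>\<^sub>i = 0\<close>, the coefficient vanishes.
\<close>

definition dz :: "'n \<Rightarrow> 'n xz_poly \<Rightarrow> 'n xz_poly"
  where "dz i f = (\<Sum>(\<alpha>, \<beta>)\<in>Poly_Mapping.keys f.
           Poly_Mapping.single (\<alpha>, \<beta> - Poly_Mapping.single i 1)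
             (Poly_Mapping.lookup f (\<alpha>, \<beta>) * of_nat (Poly_Mapping.lookup \<beta> i)))"

definition Theta :: "'n \<Rightarrow> 'n xz_poly \<Rightarrow> 'n xz_poly"
  where "Theta i f = xi i * f - dz i f"

definition Im_Theta :: "'n::finite xz_poly set"
  where "Im_Theta = {\<Sum>i\<in>UNIV. Theta i (p i) | p :: 'n \<Rightarrow> 'n xz_poly. True}"

definition zl :: "'n \<Rightarrow> 'n laurent_poly"
  where "zl i = Poly_Mapping.single (Poly_Mapping.single i 1) 1"

definition zl_inv :: "'n \<Rightarrow> 'n laurent_poly"
  where "zl_inv i = Poly_Mapping.single (Poly_Mapping.single i (-1)) 1"

definition mfact :: "'n::finite expo \<Rightarrow> complex"
  where "mfact \<beta> = (\<Prod>i\<in>UNIV. fact (Poly_Mapping.lookup \<beta> i))"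

definition mpow :: "('n::finite \<Rightarrow> 'r::comm_monoid_mult) \<Rightarrow> 'n expo \<Rightarrow> 'r"
  where "mpow x \<alpha> = (\<Prod>i\<in>UNIV. x i ^ Poly_Mapping.lookup \<alpha> i)"

text \<open>
  The linear extension of \<xi>^\<alpha> z^\<beta> \<mapsto> \<beta>! (z^{-1})^\<alpha> z^\<beta>. The lemmas at the end of the theory
  show linearity and the formula for g(\<xi>) z^\<beta> with an arbitrary polynomial g.
\<close>

definition Z_map :: "'n::finite xz_poly \<Rightarrow> 'n laurent_poly"
  where "Z_map f = (\<Sum>(\<alpha>, \<beta>)\<in>Poly_Mapping.keys f.
           const (Poly_Mapping.lookup f (\<alpha>, \<beta>) * mfact \<beta>) * mpow zl_inv \<alpha> * mpow zl \<beta>)"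

definition holomorphic_part_zero :: "'n laurent_poly \<Rightarrow> bool"
  where "holomorphic_part_zero q \<longleftrightarrow>
           (\<forall>\<gamma> :: 'n expo. Poly_Mapping.lookup q (Poly_Mapping.map int \<gamma>) = 0)"


lemma zl_mult_zl_inv: "zl i * zl_inv i = 1"
  by (simp add: zl_def zl_inv_def mult_single flip: single_add)

lemma dz_single:
  "dz i (Poly_Mapping.single (\<alpha>, \<beta>) c) =
     Poly_Mapping.single (\<alpha>, \<beta> - Poly_Mapping.single i 1) (c * of_nat (Poly_Mapping.lookup \<beta> i))"
  by (simp add: dz_def)

lemma dz_add: "dz i (f + g) = dz i f + dz i g"
proof -
  let ?t = "\<lambda>k c. Poly_Mapping.single (fst k, snd k - Poly_Mapping.single i 1)
              (c * of_nat (Poly_Mapping.lookup (snd k) i)) :: 'a xz_poly"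
  have *: "dz i h = (\<Sum>k\<in>Poly_Mapping.keys h. ?t k (Poly_Mapping.lookup h k))" for h :: "'a xz_poly"
    by (simp add: dz_def case_prod_beta)
  show ?thesis
    unfolding * by (rule setsum_keys_plus_distrib) (simp_all add: distrib_right single_add)
qed

lemma Z_map_single:
  "Z_map (Poly_Mapping.single (\<alpha>, \<beta>) c) = const (c * mfact \<beta>) * mpow zl_inv \<alpha> * mpow zl \<beta>"
  by (simp add: Z_map_def)

lemma Z_map_add: "Z_map (f + g) = Z_map f + Z_map g"
proof -
  let ?t = "\<lambda>k c. const (c * mfact (snd k)) * mpow zl_inv (fst k) * mpow zl (snd k) :: 'a laurent_poly"
  have *: "Z_map h = (\<Sum>k\<in>Poly_Mapping.keys h. ?t k (Poly_Mapping.lookup h k))" for h :: "'a xz_poly"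
    by (simp add: Z_map_def case_prod_beta)
  show ?thesis
    unfolding * by (rule setsum_keys_plus_distrib) (simp_all add: distrib_right single_add)
qed

lemma Z_map_sum: "finite A \<Longrightarrow> Z_map (\<Sum>a\<in>A. f a) = (\<Sum>a\<in>A. Z_map (f a))"
proof (induction rule: finite_induct)
  case empty
  then show ?case by (simp add: Z_map_def)
next
  case (insert a A)
  then show ?case by (simp add: Z_map_add)
qed

lemma Z_map_scale: "Z_map (const c * f) = const c * Z_map f"
proof -
  have eq: "f = (\<Sum>k\<in>Poly_Mapping.keys f. Poly_Mapping.single k (Poly_Mapping.lookup f k))"
    by (rule poly_mapping_eqI)
       (simp add: lookup_sum lookup_single when_def in_keys_iff sum.delta')
  have "Z_map (const c * (\<Sum>k\<in>Poly_Mapping.keys f. Poly_Mapping.single k (Poly_Mapping.lookup f k)))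
      = (\<Sum>k\<in>Poly_Mapping.keys f. const c * Z_map (Poly_Mapping.single k (Poly_Mapping.lookup f k)))"
    unfolding sum_distrib_left by (subst Z_map_sum; simp add: mult_single)
      (rule sum.cong[OF refl], clarsimp simp: Z_map_single mult_single mult.assoc[symmetric])
  also have "\<dots> = const c * Z_map (\<Sum>k\<in>Poly_Mapping.keys f. Poly_Mapping.single k (Poly_Mapping.lookup f k))"
    by (simp add: Z_map_sum sum_distrib_left)
  finally show ?thesis using eq by simp
qed

lemma mpow_xi: "mpow xi \<alpha> = Poly_Mapping.single (\<alpha>, 0) 1"
proof -
  have pow: "(xi i :: 'a xz_poly) ^ k = Poly_Mapping.single (Poly_Mapping.single i k, 0) 1" for i k
  proof (induction k)
    case 0
    then show ?case by (simp flip: zero_prod_def)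
  next
    case (Suc k)
    have "(xi i :: 'a xz_poly) ^ Suc k = xi i * Poly_Mapping.single (Poly_Mapping.single i k, 0) 1"
      using Suc by simp
    then show ?case by (simp add: xi_def mult_single flip: single_add)
  qed
  have "(\<Prod>i\<in>A. xi i ^ Poly_Mapping.lookup \<alpha> i) =
          Poly_Mapping.single (\<Sum>i\<in>A. Poly_Mapping.single i (Poly_Mapping.lookup \<alpha> i), 0) 1"
    if "finite A" for A
    using that by induction (simp_all add: pow mult_single flip: zero_prod_def)
  moreover have "(\<Sum>i\<in>UNIV. Poly_Mapping.single i (Poly_Mapping.lookup \<alpha> i)) = \<alpha>"
    by (rule poly_mapping_eqI) (simp add: lookup_sum lookup_single when_def)
  ultimately show ?thesis by (simp add: mpow_def)
qed

lemma mpow_zz: "mpow zz \<beta> = Poly_Mapping.single (0, \<beta>) 1"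
proof -
  have pow: "(zz i :: 'a xz_poly) ^ k = Poly_Mapping.single (0, Poly_Mapping.single i k) 1" for i k
  proof (induction k)
    case 0
    then show ?case by (simp flip: zero_prod_def)
  next
    case (Suc k)
    have "(zz i :: 'a xz_poly) ^ Suc k = zz i * Poly_Mapping.single (0, Poly_Mapping.single i k) 1"
      using Suc by simp
    then show ?case by (simp add: zz_def mult_single flip: single_add)
  qed
  have "(\<Prod>i\<in>A. zz i ^ Poly_Mapping.lookup \<beta> i) =
          Poly_Mapping.single (0, \<Sum>i\<in>A. Poly_Mapping.single i (Poly_Mapping.lookup \<beta> i)) 1"
    if "finite A" for A
    using that by induction (simp_all add: pow mult_single flip: zero_prod_def)
  moreover have "(\<Sum>i\<in>UNIV. Poly_Mapping.single i (Poly_Mapping.lookup \<beta> i)) = \<beta>"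
    by (rule poly_mapping_eqI) (simp add: lookup_sum lookup_single when_def)
  ultimately show ?thesis by (simp add: mpow_def)
qed

definition poly_subst :: "('n::finite \<Rightarrow> 'a::comm_monoid_add \<Rightarrow>\<^sub>0 complex) \<Rightarrow> ('n expo \<Rightarrow>\<^sub>0 complex)
    \<Rightarrow> 'a \<Rightarrow>\<^sub>0 complex"
  where "poly_subst x g = (\<Sum>\<alpha>\<in>Poly_Mapping.keys g. const (Poly_Mapping.lookup g \<alpha>) * mpow x \<alpha>)"

lemma Z_map_formula:
  "Z_map (poly_subst xi g * mpow zz \<beta>) = const (mfact \<beta>) * poly_subst zl_inv g * mpow zl \<beta>"
proof -
  have "Z_map (const (Poly_Mapping.lookup g \<alpha>) * mpow xi \<alpha> * mpow zz \<beta>) =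
      const (mfact \<beta>) * (const (Poly_Mapping.lookup g \<alpha>) * mpow zl_inv \<alpha>) * mpow zl \<beta>" for \<alpha>
    by (simp add: mpow_xi mpow_zz mult_single Z_map_single flip: mult.assoc)
       (simp add: mult_single mult.commute)
  then show ?thesis
    by (simp add: poly_subst_def sum_distrib_left sum_distrib_right Z_map_sum)
qed

end

theory Submission
  imports Defs
begin

text \<open>
  On monomials \<open>\<Z>(\<xi>\<^sup>\<alpha> z\<^sup>\<beta>) = \<beta>! z\<^sup>\<beta>\<^sup>-\<^sup>\<alpha>\<close>, while
  \<open>\<Theta>\<^sub>i(\<xi>\<^sup>\<alpha> z\<^sup>\<beta>) = \<xi>\<^sup>\<alpha> \<xi>\<^sub>i z\<^sup>\<beta> - \<beta>\<^sub>i \<xi>\<^sup>\<alpha> z\<^sup>\<beta> / z\<^sub>i\<close>.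
  If \<open>\<beta>\<^sub>i > 0\<close>, the two terms have the same image under \<open>\<Z>\<close>, because
  \<open>\<beta>! = \<beta>\<^sub>i (\<beta> - e\<^sub>i)!\<close>; if \<open>\<beta>\<^sub>i = 0\<close>, the second term vanishes and the image of the first
  has the negative exponent \<open>-\<alpha>\<^sub>i - 1\<close> in \<open>z\<^sub>i\<close>. Hence \<open>\<Z>\<close> maps
  the image of \<open>\<Theta>\<close> to Laurent polynomials without holomorphic part
  (\<open>holomorphic_part_zero_Z_map_Im_Theta\<close>).

  Conversely, read modulo the image of \<open>\<Theta>\<close>, the same formula trades a factor \<open>\<xi>\<^sub>i\<close> for
  the derivation \<open>\<partial>\<^sub>i\<close>, which does not raise the degree in \<open>\<xi>\<close>; by induction on this degree,
  every polynomial \<open>f\<close> is congruent to a polynomial \<open>g\<close> in \<open>z\<close> alone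
  (\<open>congruent_xi_free\<close>). By the first part, \<open>\<Z> f\<close> and \<open>\<Z> g\<close> have the same holomorphic
  part. The coefficient of \<open>z\<^sup>\<gamma>\<close> in \<open>\<Z> g\<close> is \<open>\<gamma>!\<close> times that in \<open>g\<close>, so if this part
  vanishes, then \<open>g = 0\<close> and \<open>f\<close> lies in the image.
\<close>

section \<open>Finitely supported functions\<close>

lemma lookup_map_int: "Poly_Mapping.lookup (Poly_Mapping.map int \<beta>) i = int (Poly_Mapping.lookup \<beta> i)"
  by (simp add: Poly_Mapping.map.rep_eq when_def)

lemma map_int_eq_iff: "Poly_Mapping.map int \<beta> = Poly_Mapping.map int \<gamma> \<longleftrightarrow> \<beta> = \<gamma>"
  by (metis lookup_map_int of_nat_eq_iff poly_mapping_eqI)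

lemma sum_single_lookup:
  "(\<Sum>k\<in>Poly_Mapping.keys f. Poly_Mapping.single k (Poly_Mapping.lookup f k)) = f"
  by (rule poly_mapping_eqI) (simp add: lookup_sum lookup_single when_def in_keys_iff)

lemma additive_poly_mapping_induct [case_names single add]:
  fixes f :: "'a \<Rightarrow>\<^sub>0 'b::comm_monoid_add"
  assumes single: "\<And>k v. P (Poly_Mapping.single k v)"
    and add: "\<And>f g. P f \<Longrightarrow> P g \<Longrightarrow> P (f + g)"
  shows "P f"
proof -
  have zero: "P 0"
    using single[of undefined 0] by simp
  have "P (\<Sum>k\<in>A. Poly_Mapping.single k (Poly_Mapping.lookup f k))" if "finite A" for A
    using that by induction (simp_all add: zero single add)
  from this[OF finite_keys[of f]] show ?thesis
    by (simp add: sum_single_lookup)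
qed

lemma poly_mapping_minus_single_add:
  fixes \<alpha> :: "'a expo"
  assumes "Poly_Mapping.lookup \<alpha> i \<noteq> 0"
  shows "\<alpha> - Poly_Mapping.single i 1 + Poly_Mapping.single i 1 = \<alpha>"
  using assms by (intro poly_mapping_eqI) (auto simp: lookup_add lookup_minus lookup_single when_def)


section \<open>Additivity and values on monomials\<close>

text \<open>The exponent sign \<open>s\<close> is 1 for \<^const>\<open>zl\<close> and -1 for \<^const>\<open>zl_inv\<close>.\<close>

lemma mpow_single:
  fixes \<alpha> :: "'n::finite expo" and x :: "'n \<Rightarrow> 'n laurent_poly"
  assumes x: "\<And>i. x i = Poly_Mapping.single (Poly_Mapping.single i s) 1"
  shows "mpow x \<alpha> = Poly_Mapping.single
           (\<Sum>i\<in>UNIV. Poly_Mapping.single i (s * int (Poly_Mapping.lookup \<alpha> i))) 1"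
proof -
  have pow: "x i ^ k = Poly_Mapping.single (Poly_Mapping.single i (s * int k)) 1" for i k
  proof (induction k)
    case (Suc k)
    have "Poly_Mapping.single i s + Poly_Mapping.single i (s * int k) =
          Poly_Mapping.single i (s * int (Suc k))"
      by (simp add: distrib_left flip: single_add)
    then show ?case
      unfolding power_Suc Suc.IH unfolding x by (simp add: mult_single del: of_nat_Suc)
  qed simp
  have "(\<Prod>i\<in>A. x i ^ Poly_Mapping.lookup \<alpha> i) = Poly_Mapping.single
      (\<Sum>i\<in>A. Poly_Mapping.single i (s * int (Poly_Mapping.lookup \<alpha> i))) 1" if "finite A" for A
    using that by induction (simp_all add: pow mult_single)
  then show ?thesis by (simp add: mpow_def)
qed

lemma Z_map_monomial:
  "Z_map (Poly_Mapping.single (\<alpha>, \<beta>) c) =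
     Poly_Mapping.single (Poly_Mapping.map int \<beta> - Poly_Mapping.map int \<alpha>) (c * mfact \<beta>)"
proof -
  \<comment> \<open>The factors 1 and -1 are kept so that the sums match \<open>mpow_single\<close> literally.\<close>
  have "(\<Sum>i\<in>UNIV. Poly_Mapping.single i (1 * int (Poly_Mapping.lookup \<beta> i))) =
          Poly_Mapping.map int \<beta>"
    by (rule poly_mapping_eqI) (simp add: lookup_sum lookup_single when_def lookup_map_int)
  then have "mpow zl \<beta> = Poly_Mapping.single (Poly_Mapping.map int \<beta>) 1"
    using mpow_single[OF zl_def, of \<beta>] by (simp only:)
  moreover have "(\<Sum>i\<in>UNIV. Poly_Mapping.single i (-1 * int (Poly_Mapping.lookup \<alpha> i))) =
          - Poly_Mapping.map int \<alpha>"
    by (rule poly_mapping_eqI) (simp add: lookup_sum lookup_single when_def lookup_map_int)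
  then have "mpow zl_inv \<alpha> = Poly_Mapping.single (- Poly_Mapping.map int \<alpha>) 1"
    using mpow_single[OF zl_inv_def, of \<alpha>] by (simp only:)
  ultimately show ?thesis
    by (simp add: Z_map_single mult_single)
qed

lemma Z_map_diff: "Z_map (f - g) = Z_map f - Z_map g"
  using Z_map_add[of "f - g" g] by (simp add: algebra_simps)

lemma Theta_add: "Theta i (f + g) = Theta i f + Theta i g"
  by (simp add: Theta_def dz_add algebra_simps)

lemma Theta_0: "Theta i 0 = 0"
  using Theta_add[of i 0 0] by simp

lemma Theta_monomial:
  "Theta i (Poly_Mapping.single (\<alpha>, \<beta>) c) =
     Poly_Mapping.single (\<alpha> + Poly_Mapping.single i 1, \<beta>) c -
     Poly_Mapping.single (\<alpha>, \<beta> - Poly_Mapping.single i 1) (c * of_nat (Poly_Mapping.lookup \<beta> i))"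
  by (simp add: Theta_def dz_single xi_def mult_single add.commute)

lemma holomorphic_part_zero_0: "holomorphic_part_zero 0"
  by (simp add: holomorphic_part_zero_def)

lemma holomorphic_part_zero_add:
  "holomorphic_part_zero p \<Longrightarrow> holomorphic_part_zero q \<Longrightarrow> holomorphic_part_zero (p + q)"
  by (simp add: holomorphic_part_zero_def lookup_add)

lemma holomorphic_part_zero_diff:
  "holomorphic_part_zero p \<Longrightarrow> holomorphic_part_zero q \<Longrightarrow> holomorphic_part_zero (p - q)"
  by (simp add: holomorphic_part_zero_def lookup_minus)


section \<open>The image of Theta has no holomorphic part\<close>

lemma mfact_nonzero: "mfact \<beta> \<noteq> 0"
  by (simp add: mfact_def)

lemma mfact_add_single:
  "mfact (\<beta> + Poly_Mapping.single i 1) = of_nat (Suc (Poly_Mapping.lookup \<beta> i)) * mfact \<beta>"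
proof -
  have "(\<Prod>j\<in>UNIV - {i}. fact (Poly_Mapping.lookup (\<beta> + Poly_Mapping.single i 1) j)) =
        (\<Prod>j\<in>UNIV - {i}. fact (Poly_Mapping.lookup \<beta> j) :: complex)"
    by (rule prod.cong) (auto simp: lookup_add lookup_single when_def)
  moreover have "mfact \<delta> = fact (Poly_Mapping.lookup \<delta> i) *
      (\<Prod>j\<in>UNIV - {i}. fact (Poly_Mapping.lookup \<delta> j))" for \<delta>
    unfolding mfact_def by (rule prod.remove) simp_all
  ultimately show ?thesis
    by (simp add: lookup_add)
qed

lemma holomorphic_part_zero_Theta_monomial:
  "holomorphic_part_zero (Z_map (Theta i (Poly_Mapping.single (\<alpha>, \<beta>) c)))"
proof (cases "Poly_Mapping.lookup \<beta> i = 0")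
  case True
  have "Poly_Mapping.map int \<beta> - Poly_Mapping.map int (\<alpha> + Poly_Mapping.single i 1)
          \<noteq> Poly_Mapping.map int \<gamma>" for \<gamma>
  proof
    assume "Poly_Mapping.map int \<beta> - Poly_Mapping.map int (\<alpha> + Poly_Mapping.single i 1)
              = Poly_Mapping.map int \<gamma>"
    from arg_cong[OF this, of "\<lambda>p. Poly_Mapping.lookup p i"] True show False
      by (simp add: lookup_minus lookup_add lookup_map_int)
  qed
  with True show ?thesis
    by (simp add: Theta_monomial Z_map_monomial holomorphic_part_zero_def lookup_single when_def)
next
  case False
  define \<beta>' where "\<beta>' = \<beta> - Poly_Mapping.single i 1"
  have \<beta>: "\<beta> = \<beta>' + Poly_Mapping.single i 1"
    using poly_mapping_minus_single_add[OF False] by (simp add: \<beta>'_def)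
  have "Poly_Mapping.map int \<beta> - Poly_Mapping.map int (\<alpha> + Poly_Mapping.single i 1) =
        Poly_Mapping.map int \<beta>' - Poly_Mapping.map int \<alpha>"
    by (rule poly_mapping_eqI) (simp add: \<beta> lookup_minus lookup_add lookup_map_int)
  moreover have "mfact \<beta> = of_nat (Poly_Mapping.lookup \<beta> i) * mfact \<beta>'"
    unfolding \<beta> mfact_add_single by (simp add: lookup_add)
  ultimately have "Z_map (Theta i (Poly_Mapping.single (\<alpha>, \<beta>) c)) = 0"
    unfolding Theta_monomial \<beta>'_def[symmetric] by (simp add: Z_map_diff Z_map_monomial mult_ac)
  then show ?thesis by (simp add: holomorphic_part_zero_0)
qed

lemma holomorphic_part_zero_Theta: "holomorphic_part_zero (Z_map (Theta i f))"
proof (induction f rule: additive_poly_mapping_induct)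
  case (single k v)
  then show ?case by (cases k) (simp only: holomorphic_part_zero_Theta_monomial)
next
  case (add f g)
  then show ?case by (simp add: Theta_add Z_map_add holomorphic_part_zero_add)
qed

lemma holomorphic_part_zero_Z_map_Im_Theta:
  assumes "f \<in> Im_Theta"
  shows "holomorphic_part_zero (Z_map f)"
proof -
  obtain p where "f = (\<Sum>i\<in>UNIV. Theta i (p i))"
    using assms by (auto simp: Im_Theta_def)
  moreover have "holomorphic_part_zero (Z_map (Theta i (p i)))" for i
    by (rule holomorphic_part_zero_Theta)
  ultimately show ?thesis
    by (simp add: Z_map_sum holomorphic_part_zero_def lookup_sum)
qed


section \<open>Reduction to polynomials in z modulo the image of Theta\<close>

lemma Theta_in_Im_Theta: "Theta i f \<in> Im_Theta"
proof -
  have "Theta i f = (\<Sum>j\<in>UNIV. if j = i then Theta j f else 0)" by simp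
  also have "\<dots> = (\<Sum>j\<in>UNIV. Theta j (if j = i then f else 0))"
    by (rule sum.cong) (auto simp: Theta_0)
  finally show ?thesis by (auto simp: Im_Theta_def)
qed

lemma Im_Theta_add:
  assumes "f \<in> Im_Theta" "g \<in> Im_Theta"
  shows "f + g \<in> Im_Theta"
proof -
  obtain p q where "f = (\<Sum>i\<in>UNIV. Theta i (p i))" "g = (\<Sum>i\<in>UNIV. Theta i (q i))"
    using assms by (auto simp: Im_Theta_def)
  then have "f + g = (\<Sum>i\<in>UNIV. Theta i (p i + q i))"
    by (simp add: Theta_add sum.distrib)
  then show ?thesis by (auto simp: Im_Theta_def)
qed

lemma Im_Theta_0: "0 \<in> Im_Theta"
  by (metis Theta_0 Theta_in_Im_Theta)

text \<open>The reduction of a monomial ends in a single monomial, possibly with coefficient zero.\<close>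

lemma monomial_congruent_xi_free:
  fixes \<alpha> \<beta> :: "'n::finite expo"
  shows "\<exists>\<gamma> d. Poly_Mapping.single (\<alpha>, \<beta>) c - Poly_Mapping.single (0, \<gamma>) d \<in> Im_Theta"
proof (induction "\<Sum>i\<in>UNIV. Poly_Mapping.lookup \<alpha> i" arbitrary: \<alpha> \<beta> c)
  case 0
  then have "\<alpha> = 0" by (intro poly_mapping_eqI) simp
  then show ?case by (metis Im_Theta_0 diff_self)
next
  case (Suc n)
  then obtain i where i: "Poly_Mapping.lookup \<alpha> i \<noteq> 0"
    by (cases "\<forall>i. Poly_Mapping.lookup \<alpha> i = 0") auto
  define \<alpha>' where "\<alpha>' = \<alpha> - Poly_Mapping.single i 1"
  have \<alpha>: "\<alpha> = \<alpha>' + Poly_Mapping.single i 1"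
    using poly_mapping_minus_single_add[OF i] by (simp add: \<alpha>'_def)
  have "n = (\<Sum>j\<in>UNIV. Poly_Mapping.lookup \<alpha>' j)"
    using Suc(2) by (simp add: \<alpha> lookup_add sum.distrib lookup_single when_def)
  from Suc(1)[OF this] obtain \<gamma> d where
    "Poly_Mapping.single (\<alpha>', \<beta> - Poly_Mapping.single i 1) (c * of_nat (Poly_Mapping.lookup \<beta> i))
       - Poly_Mapping.single (0, \<gamma>) d \<in> Im_Theta" by blast
  from Im_Theta_add[OF Theta_in_Im_Theta[of i "Poly_Mapping.single (\<alpha>', \<beta>) c"] this]
  have "Poly_Mapping.single (\<alpha>, \<beta>) c - Poly_Mapping.single (0, \<gamma>) d \<in> Im_Theta"
    by (simp only: Theta_monomial \<alpha> diff_add_cancel diff_add_eq add_diff_eq)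
  then show ?case by blast
qed

lemma congruent_xi_free:
  fixes f :: "'n::finite xz_poly"
  shows "\<exists>g. f - g \<in> Im_Theta \<and> Poly_Mapping.keys g \<subseteq> {0} \<times> UNIV"
proof (induction f rule: additive_poly_mapping_induct)
  case (single k v)
  obtain \<gamma> d where "Poly_Mapping.single k v - Poly_Mapping.single (0, \<gamma>) d \<in> Im_Theta"
    using monomial_congruent_xi_free by (cases k) blast
  then show ?case
    by (intro exI[of _ "Poly_Mapping.single (0, \<gamma>) d"]) auto
next
  case (add f1 f2)
  then obtain g1 g2 where g: "f1 - g1 \<in> Im_Theta" "Poly_Mapping.keys g1 \<subseteq> {0} \<times> UNIV"
    "f2 - g2 \<in> Im_Theta" "Poly_Mapping.keys g2 \<subseteq> {0} \<times> UNIV" by blast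
  have "f1 + f2 - (g1 + g2) \<in> Im_Theta"
    using Im_Theta_add[OF g(1,3)] by (simp add: algebra_simps)
  moreover have "Poly_Mapping.keys (g1 + g2) \<subseteq> {0} \<times> UNIV"
    using keys_add[of g1 g2] g(2,4) by blast
  ultimately show ?case by blast
qed

lemma lookup_Z_map_xi_free:
  fixes g :: "'n::finite xz_poly"
  assumes "Poly_Mapping.keys g \<subseteq> {0} \<times> UNIV"
  shows "Poly_Mapping.lookup (Z_map g) (Poly_Mapping.map int \<gamma>) =
           mfact \<gamma> * Poly_Mapping.lookup g (0, \<gamma>)"
proof -
  have "Poly_Mapping.lookup (Z_map g) (Poly_Mapping.map int \<gamma>) = Poly_Mapping.lookup
      (Z_map (\<Sum>k\<in>Poly_Mapping.keys g. Poly_Mapping.single k (Poly_Mapping.lookup g k)))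
      (Poly_Mapping.map int \<gamma>)"
    by (simp add: sum_single_lookup)
  also have "\<dots> = (\<Sum>k\<in>Poly_Mapping.keys g. Poly_Mapping.lookup
      (Z_map (Poly_Mapping.single k (Poly_Mapping.lookup g k))) (Poly_Mapping.map int \<gamma>))"
    by (simp add: Z_map_sum lookup_sum)
  also have "\<dots> = (\<Sum>k\<in>Poly_Mapping.keys g.
      if k = (0, \<gamma>) then mfact \<gamma> * Poly_Mapping.lookup g (0, \<gamma>) else 0)"
  proof (rule sum.cong[OF refl])
    fix k assume "k \<in> Poly_Mapping.keys g"
    with assms obtain \<beta> where k: "k = (0, \<beta>)" by (cases k) auto
    have "Poly_Mapping.map int (0 :: 'n expo) = 0"
      by (rule poly_mapping_eqI) (simp add: lookup_map_int)
    then show "Poly_Mapping.lookup (Z_map (Poly_Mapping.single k (Poly_Mapping.lookup g k)))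
          (Poly_Mapping.map int \<gamma>) =
        (if k = (0, \<gamma>) then mfact \<gamma> * Poly_Mapping.lookup g (0, \<gamma>) else 0)"
      by (auto simp: k Z_map_monomial lookup_single when_def map_int_eq_iff)
  qed
  also have "\<dots> = mfact \<gamma> * Poly_Mapping.lookup g (0, \<gamma>)"
    by (simp add: in_keys_iff)
  finally show ?thesis .
qed


section \<open>Characterization of the image\<close>

theorem theorem3p9:
  fixes f :: "'n::finite xz_poly"
  shows "f \<in> Im_Theta \<longleftrightarrow> holomorphic_part_zero (Z_map f)"
proof
  assume "f \<in> Im_Theta"
  then show "holomorphic_part_zero (Z_map f)"
    by (rule holomorphic_part_zero_Z_map_Im_Theta)
next
  assume f: "holomorphic_part_zero (Z_map f)"
  obtain g where g: "f - g \<in> Im_Theta" "Poly_Mapping.keys g \<subseteq> {0} \<times> UNIV"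
    using congruent_xi_free by blast
  have "Z_map g = Z_map f - Z_map (f - g)"
    by (simp add: Z_map_diff)
  then have "holomorphic_part_zero (Z_map g)"
    using holomorphic_part_zero_diff[OF f holomorphic_part_zero_Z_map_Im_Theta[OF g(1)]] by simp
  then have "(0, \<gamma>) \<notin> Poly_Mapping.keys g" for \<gamma>
    using lookup_Z_map_xi_free[OF g(2), of \<gamma>] mfact_nonzero[of \<gamma>]
    by (simp add: holomorphic_part_zero_def in_keys_iff)
  then have "Poly_Mapping.keys g = {}"
    using g(2) by blast
  then have "g = 0" by simp
  with g(1) show "f \<in> Im_Theta" by simp
qed

end
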